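(* Let $(A,\varphi)$ be a noncommutative probability space over $B$ with $\varphi$ a $B$-trace, and let $x,y\in(A,\varphi)$ be $B$-valued random variables. Then the pair $(x,y)$ is an R-diagonal pair if and only if the only nonvanishing mixed $B$-cumulants of $x$ and $y$ are $$k_{2n}(\underbrace{x,y,x,y,\dots,x,y}_{2n\text{ times}})\qquad\text{and}\qquad k_{2n}(\underbrace{y,x,y,x,\dots,y,x}_{2n\text{ times}}),$$ for all $n\in\mathbb N$.
   Context: A noncommutative probability space over $B$ is a pair $(A,\varphi)$, where $A$ is a unital complex algebra, $B\subset A$ is a subalgebra with $1_B=1_A$, and $\varphi:A\to B$ is linear with $\varphi(b)=b$ and $\varphi(bab')=b\varphi(a)b'$ for $b,b'\in B$, $a\in A$. Elements of $A$ are called $B$-valued random variables. $\varphi$ is a $B$-trace if $\varphi(aa')=\varphi(a'a)$ for all $a,a'\in A$. $NC(n)$ is the lattice of noncrossing partitions of $\{1,\dots,n\}$ ordered by refinement, with maximal element $1_n$ and Möbius function $\mu$. For $\pi\in NC(n)$, $\widehat\varphi(\pi)(a_1\otimes\cdots\otimes a_n)\in B$ is defined recursively. Put $\widehat\varphi(1_n)(a_1\otimes\cdots\otimes a_n)=\varphi(a_1\cdots a_n)$. If $\pi\ne1_n$, choose a block of $\pi$ that is an interval $\{l+1,\dots,l+s\}$, set $\beta=\varphi(a_{l+1}\cdots a_{l+s})$, remove the block, replace $a_l$ by $a_l\beta$ (if $l=0$, replace $a_{s+1}$ by $\beta a_{s+1}$ instead), and apply $\widehat\varphi$ of the remaining partition.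 The $B$-valued cumulants are $c^{(n)}(a_1\otimes\cdots\otimes a_n)=\sum_{\pi\in NC(n)}\widehat\varphi(\pi)(a_1\otimes\cdots\otimes a_n)\,\mu(\pi,1_n)$. For $B$-valued random variables $x_1,\dots,x_s$ the $(i_1,\dots,i_n)$-th $B$-cumulant is $k_n(x_{i_1},\dots,x_{i_n})=c^{(n)}(x_{i_1}\otimes b_{i_2}x_{i_2}\otimes\cdots\otimes b_{i_n}x_{i_n})$, where $b_{i_2},\dots,b_{i_n}\in B$ are arbitrary. A mixed $B$-cumulant of $x$ and $y$ is a cumulant $k_n(x_{i_1},\dots,x_{i_n})$ with each $x_{i_j}\in\{x,y\}$ and with both $x$ and $y$ occurring. $\Theta_B^s$ is the set of formal series $\sum_{n\ge1}\sum_{i_1,\dots,i_n\in\{1,\dots,s\}}b_{i_1,\dots,i_n}z_{i_1}\cdots z_{i_n}$ in noncommuting indeterminates $z_1,\dots,z_s$ with coefficients in $B$. The R-transform of $x_1,\dots,x_s$ is the series $R_{x_1,\dots,x_s}(z_1,\dots,z_s)=\sum_{n\ge1}\sum_{i_1,\dots,i_n\in\{1,\dots,s\}}k_n(x_{i_1},\dots,x_{i_n})z_{i_1}\cdots z_{i_n}\in\Theta_B^s$. A pair $(x_1,x_2)$ of $B$-valued random variables is R-diagonal if there exist $f,g\in\Theta_B^1$ such that $R_{x_1,x_2}(z_1,z_2)=f(z_1z_2)+g(z_2z_1)$.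
   Formalization: The right-hand side also requires all pure cumulants k_n(x,...,x) and k_n(y,...,y) to vanish; without this the "if" direction fails (A=B=C, φ=id, x=1, y=0). *)

theory Defs
  imports Complex_Main "HOL-Library.Disjoint_Sets"
begin

section \<open>Noncommutative probability spaces over a subalgebra\<close>

text \<open>The ambient algebra is the whole type \<open>'a\<close>; its complex scalar multiplication is the
  parameter \<open>scale\<close>. The sort is weaker than \<open>ring_1\<close>, which excludes the zero algebra.\<close>

locale complex_algebra = vector_space scale
  for scale :: "complex \<Rightarrow> 'a::{ring, monoid_mult} \<Rightarrow> 'a" +
  assumes scale_mult_left: "scale c (a * a') = scale c a * a'"
    and scale_mult_right: "scale c (a * a') = a * scale c a'"

locale ncps = complex_algebra scale
  for scale :: "complex \<Rightarrow> 'a::{ring, monoid_mult} \<Rightarrow> 'a" +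
  fixes B :: "'a set" and \<phi> :: "'a \<Rightarrow> 'a"
  assumes B_subspace: "subspace B"
    and B_one: "1 \<in> B"
    and B_mult: "\<lbrakk>b \<in> B; b' \<in> B\<rbrakk> \<Longrightarrow> b * b' \<in> B"
    and phi_linear: "Vector_Spaces.linear scale scale \<phi>"
    and phi_range: "\<phi> a \<in> B"
    and phi_id: "b \<in> B \<Longrightarrow> \<phi> b = b"
    and phi_bimodule: "\<lbrakk>b \<in> B; b' \<in> B\<rbrakk> \<Longrightarrow> \<phi> (b * a * b') = b * \<phi> a * b'"

definition B_trace :: "('a::{ring, monoid_mult} \<Rightarrow> 'a) \<Rightarrow> bool" where
  "B_trace \<phi> \<longleftrightarrow> (\<forall>a a'. \<phi> (a * a') = \<phi> (a' * a))"


section \<open>Noncrossing partitions and their Moebius function\<close>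

definition noncrossing :: "nat set set \<Rightarrow> bool" where
  "noncrossing \<pi> \<longleftrightarrow>
     (\<forall>U\<in>\<pi>. \<forall>V\<in>\<pi>. \<forall>a\<in>U. \<forall>b\<in>V. \<forall>c\<in>U. \<forall>d\<in>V. a < b \<and> b < c \<and> c < d \<longrightarrow> U = V)"

definition NC :: "nat \<Rightarrow> nat set set set" where
  "NC n = {\<pi>. partition_on {1..n} \<pi> \<and> noncrossing \<pi>}"

lemma finite_NC: "finite (NC n)"
proof (rule finite_subset)
  show "NC n \<subseteq> Pow (Pow {1..n})"
    by (auto simp: NC_def partition_on_def)
qed simp

text \<open>The Moebius function of \<open>NC n\<close> under \<^const>\<open>refines\<close>, by the recursion
  \<open>\<Sum>\<^sub>\<tau> \<mu>(\<pi>,\<tau>) = 0\<close> over \<open>\<pi> \<le> \<tau> \<le> \<sigma>\<close>, for \<open>\<pi> < \<sigma>\<close>.\<close>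

function nc_mu :: "nat \<Rightarrow> nat set set \<Rightarrow> nat set set \<Rightarrow> int" where
  "nc_mu n \<pi> \<sigma> =
     (if \<pi> = \<sigma> then 1
      else if \<pi> \<in> NC n \<and> \<sigma> \<in> NC n \<and> refines {1..n} \<pi> \<sigma>
      then - (\<Sum>\<tau> | \<tau> \<in> NC n \<and> refines {1..n} \<pi> \<tau> \<and> refines {1..n} \<tau> \<sigma> \<and> \<tau> \<noteq> \<sigma>. nc_mu n \<pi> \<tau>)
      else 0)"
  by pat_completeness auto
termination
proof (relation "measure (\<lambda>(n, \<pi>, \<sigma>). card {\<rho> \<in> NC n. refines {1..n} \<rho> \<sigma>})")
  fix n :: nat and \<pi> \<sigma> \<tau> :: "nat set set"
  assume A: "\<pi> \<in> NC n \<and> \<sigma> \<in> NC n \<and> refines {1..n} \<pi> \<sigma>"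
    and "\<tau> \<in> {\<tau>. \<tau> \<in> NC n \<and> refines {1..n} \<pi> \<tau> \<and> refines {1..n} \<tau> \<sigma> \<and> \<tau> \<noteq> \<sigma>}"
  then have t: "refines {1..n} \<tau> \<sigma>" "\<tau> \<noteq> \<sigma>" by auto
  have "refines {1..n} \<sigma> \<sigma>" "\<not> refines {1..n} \<sigma> \<tau>"
    using t A refines_asym by (auto simp: NC_def intro: refines_refl)
  then have "{\<rho> \<in> NC n. refines {1..n} \<rho> \<tau>} \<subset> {\<rho> \<in> NC n. refines {1..n} \<rho> \<sigma>}"
    using t A refines_trans by blast
  then show "((n, \<pi>, \<tau>), (n, \<pi>, \<sigma>)) \<in> measure (\<lambda>(n, \<pi>, \<sigma>). card {\<rho> \<in> NC n. refines {1..n} \<rho> \<sigma>})"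
    by (simp add: psubset_card_mono finite_NC)
qed simp

declare nc_mu.simps [simp del]


section \<open>The multiplicative extension of the expectation\<close>

text \<open>The arguments \<open>a\<^sub>1, ..., a\<^sub>n\<close> are given as a function on positions. When a block is removed,
  the remaining positions keep their labels instead of being renumbered, so \<open>\<pi>\<close> ranges over
  partitions of arbitrary finite sets \<open>\<Union>\<pi>\<close> of positions, and "interval" means: convex in \<open>\<Union>\<pi>\<close>.\<close>

definition interval_block :: "nat set set \<Rightarrow> nat set \<Rightarrow> bool" where
  "interval_block \<pi> V \<longleftrightarrow> V \<in> \<pi> \<and> finite V \<and> V \<noteq> {} \<and> (\<forall>p\<in>\<Union>\<pi>. Min V \<le> p \<and> p \<le> Max V \<longrightarrow> p \<in> V)"

definition block_prod :: "(nat \<Rightarrow> 'a::monoid_mult) \<Rightarrow> nat set \<Rightarrow> 'a" where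
  "block_prod a V = prod_list (map a (sorted_list_of_set V))"

text \<open>\<open>S\<close> is the set of positions left after removing \<open>V\<close>. The value \<open>\<beta>\<close> of \<open>V\<close> is multiplied on the
  right of the argument preceding \<open>V\<close>, or, if there is none, on the left of the one following \<open>V\<close>.\<close>

definition absorb :: "nat set \<Rightarrow> nat set \<Rightarrow> 'a::times \<Rightarrow> (nat \<Rightarrow> 'a) \<Rightarrow> nat \<Rightarrow> 'a" where
  "absorb S V \<beta> a =
     (if \<exists>p\<in>S. p < Min V
      then let l = Max {p \<in> S. p < Min V} in a(l := a l * \<beta>)
      else let r = Min {p \<in> S. Max V < p} in a(r := \<beta> * a r))"

text \<open>A noncrossing partition of a nonempty finite set always has an interval block, so the value
  \<open>0\<close> below is never used on such partitions. By the bimodule property of \<open>\<phi>\<close> the result does not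
  depend on the interval block that is chosen.\<close>

function phi_hat :: "('a::{ring, monoid_mult} \<Rightarrow> 'a) \<Rightarrow> nat set set \<Rightarrow> (nat \<Rightarrow> 'a) \<Rightarrow> 'a" where
  "phi_hat \<phi> \<pi> a =
     (if finite \<pi> \<and> (\<exists>V. interval_block \<pi> V)
      then let V = (SOME V. interval_block \<pi> V); \<beta> = \<phi> (block_prod a V) in
        if \<pi> = {V} then \<beta>
        else phi_hat \<phi> (\<pi> - {V}) (absorb (\<Union>(\<pi> - {V})) V \<beta> a)
      else 0)"
  by pat_completeness auto
termination
proof (relation "measure (\<lambda>(\<phi>, \<pi>, a). card \<pi>)", goal_cases)
  case (2 \<phi> \<pi> a V \<beta>)
  then have "interval_block \<pi> V" using someI_ex[of "interval_block \<pi>"] by simp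
  then have "V \<in> \<pi>" by (simp add: interval_block_def)
  moreover have "finite \<pi>" using 2 by blast
  ultimately show ?case by (auto intro: card_Diff1_less simp del: card_Diff_insert card_Diff_singleton)
qed simp

declare phi_hat.simps [simp del]


section \<open>Cumulants\<close>

definition cumulant ::
  "(complex \<Rightarrow> 'a::{ring, monoid_mult} \<Rightarrow> 'a) \<Rightarrow> ('a \<Rightarrow> 'a) \<Rightarrow> nat \<Rightarrow> (nat \<Rightarrow> 'a) \<Rightarrow> 'a" where
  "cumulant scale \<phi> n a = (\<Sum>\<pi>\<in>NC n. scale (of_int (nc_mu n \<pi> {{1..n}})) (phi_hat \<phi> \<pi> a))"

text \<open>Variables \<open>x\<^sub>1, ..., x\<^sub>s\<close> form a list \<open>xs\<close>; an index tuple \<open>(i\<^sub>1, ..., i\<^sub>n)\<close> is a word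
  \<open>w\<close> over \<open>{1..s}\<close>. Position \<open>j\<close> of \<open>w\<close> (counted from \<open>1\<close>) contributes \<open>b j * x\<^sub>i\<close>, where \<open>i\<close> is the \<open>j\<close>-th
  letter, except that there is no coefficient at position \<open>1\<close>.\<close>

definition B_cumulant ::
  "(complex \<Rightarrow> 'a::{ring, monoid_mult} \<Rightarrow> 'a) \<Rightarrow> ('a \<Rightarrow> 'a) \<Rightarrow> 'a list \<Rightarrow> nat list \<Rightarrow> (nat \<Rightarrow> 'a) \<Rightarrow> 'a" where
  "B_cumulant scale \<phi> xs w b =
     cumulant scale \<phi> (length w)
       (\<lambda>j. let x = xs ! (w ! (j - 1) - 1) in if j = 1 then x else b j * x)"

text \<open>The coefficients \<open>b\<^sub>2, ..., b\<^sub>n\<close> are arbitrary in \<open>B\<close>: a cumulant vanishes if it is \<open>0\<close> for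
  all of them.\<close>

definition vanishing_B_cumulant ::
  "(complex \<Rightarrow> 'a::{ring, monoid_mult} \<Rightarrow> 'a) \<Rightarrow> 'a set \<Rightarrow> ('a \<Rightarrow> 'a) \<Rightarrow> 'a list \<Rightarrow> nat list \<Rightarrow> bool" where
  "vanishing_B_cumulant scale B \<phi> xs w \<longleftrightarrow> (\<forall>b. range b \<subseteq> B \<longrightarrow> B_cumulant scale \<phi> xs w b = 0)"

text \<open>Words of the mixed cumulants, resp. of the cumulants of a single one, of two variables.\<close>

definition mixed_word :: "nat list \<Rightarrow> bool" where
  "mixed_word w \<longleftrightarrow> set w = {1, 2}"

definition pure_word :: "nat list \<Rightarrow> bool" where
  "pure_word w \<longleftrightarrow> set w = {1} \<or> set w = {2}"


section \<open>Formal series, R-transform, R-diagonal pairs\<close>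

text \<open>A series in noncommuting indeterminates \<open>z\<^sub>1, ..., z\<^sub>s\<close> is its coefficient function on words.\<close>

definition Theta :: "'a::zero set \<Rightarrow> nat \<Rightarrow> (nat list \<Rightarrow> 'a) set" where
  "Theta B s = {f. (\<forall>w. w \<noteq> [] \<and> set w \<subseteq> {1..s} \<longrightarrow> f w \<in> B) \<and>
                   (\<forall>w. \<not> (w \<noteq> [] \<and> set w \<subseteq> {1..s}) \<longrightarrow> f w = 0)}"

definition word_power :: "nat list \<Rightarrow> nat \<Rightarrow> nat list" where
  "word_power m n = concat (replicate n m)"

text \<open>\<open>f(m)\<close> for a series \<open>f\<close> in one indeterminate and a nonempty word \<open>m\<close>: the coefficient of
  \<open>z\<^sup>n\<close> becomes that of \<open>m\<^sup>n\<close>. Only \<open>n \<le> length w\<close> can satisfy \<open>m\<^sup>n = w\<close>.\<close>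

definition subst_word :: "(nat list \<Rightarrow> 'a::comm_monoid_add) \<Rightarrow> nat list \<Rightarrow> nat list \<Rightarrow> 'a" where
  "subst_word f m w = (\<Sum>n | n \<in> {1..length w} \<and> word_power m n = w. f (replicate n 1))"

text \<open>The R-transform depends on the coefficients inserted in the cumulants: \<open>b w\<close> are those
  used for the word \<open>w\<close>.\<close>

definition R_transform ::
  "(complex \<Rightarrow> 'a::{ring, monoid_mult} \<Rightarrow> 'a) \<Rightarrow> ('a \<Rightarrow> 'a) \<Rightarrow> 'a list \<Rightarrow> (nat list \<Rightarrow> nat \<Rightarrow> 'a)
     \<Rightarrow> nat list \<Rightarrow> 'a" where
  "R_transform scale \<phi> xs b w =
     (if w \<noteq> [] \<and> set w \<subseteq> {1..length xs} then B_cumulant scale \<phi> xs w (b w) else 0)"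

text \<open>The series \<open>f\<close> and \<open>g\<close> depend on the inserted coefficients, as the R-transform does.\<close>

definition R_diagonal ::
  "(complex \<Rightarrow> 'a::{ring, monoid_mult} \<Rightarrow> 'a) \<Rightarrow> 'a set \<Rightarrow> ('a \<Rightarrow> 'a) \<Rightarrow> 'a \<Rightarrow> 'a \<Rightarrow> bool" where
  "R_diagonal scale B \<phi> x\<^sub>1 x\<^sub>2 \<longleftrightarrow>
     (\<forall>b. (\<forall>w. range (b w) \<subseteq> B) \<longrightarrow>
       (\<exists>f\<in>Theta B 1. \<exists>g\<in>Theta B 1. \<forall>w.
          R_transform scale \<phi> [x\<^sub>1, x\<^sub>2] b w = subst_word f [1, 2] w + subst_word g [2, 1] w))"

end

theory Submission
  imports Defs
begin

text \<open>The theorem is a comparison of coefficients. The series f(z1 z2) + g(z2 z1) is supported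
  on the powers of the words 12 and 21, and its coefficients there can be prescribed freely in
  \<open>B\<close>, because no nonempty word is a power of both. So R-diagonality means that the
  cumulants of all other nonempty words in 1 and 2 vanish, for every choice of inserted
  coefficients. \<open>R_diagonal_imp_B_cumulant_eq_0\<close> reads off the zero coefficients;
  \<open>R_diagonalI\<close> builds f and g from the surviving cumulants, which
  \<open>B_cumulant_in_B\<close> makes admissible coefficients. The words split into mixed and pure
  ones, and a pure word is never a positive power of 12 or 21.\<close>

lemma (in ncps) phi_hat_in_B: "phi_hat \<phi> \<pi> a \<in> B"
proof (induction "card \<pi>" arbitrary: \<pi> a rule: less_induct)
  case less
  define V where "V = (SOME V. interval_block \<pi> V)"
  show ?case
  proof (cases "finite \<pi> \<and> (\<exists>V. interval_block \<pi> V)")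
    case True
    then have "V \<in> \<pi>"
      unfolding V_def by (metis interval_block_def someI_ex)
    then have "card (\<pi> - {V}) < card \<pi>"
      using True by (intro card_Diff1_less) auto
    then show ?thesis
      by (subst phi_hat.simps) (simp add: True Let_def less.hyps phi_range flip: V_def)
  next
    \<comment> \<open>Here \<open>phi_hat\<close> takes its default value 0, which lies in the
      subspace \<open>B\<close>.\<close>
    case False
    then show ?thesis
      using subspace_0[OF B_subspace] by (subst phi_hat.simps) (simp only: if_False)
  qed
qed

lemma (in ncps) B_cumulant_in_B: "B_cumulant scale \<phi> xs w b \<in> B"
  unfolding B_cumulant_def cumulant_def
  by (intro subspace_sum subspace_scale B_subspace phi_hat_in_B)

lemma length_word_power [simp]: "length (word_power m n) = n * length m"
  by (induction n) (simp_all add: word_power_def)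

lemma set_word_power: "n \<ge> 1 \<Longrightarrow> set (word_power m n) = set m"
  by (auto simp: word_power_def)

lemma hd_word_power: "n \<ge> 1 \<Longrightarrow> m \<noteq> [] \<Longrightarrow> hd (word_power m n) = hd m"
  by (cases n) (simp_all add: word_power_def)

text \<open>Powers of a nonempty word are told apart by their lengths, so the sum defining
  \<open>subst_word\<close> has a single term; its exponent is in range since
  \<open>n \<le> n * length m\<close>.\<close>

lemma subst_word_word_power:
  assumes "m \<noteq> []" "n \<ge> 1"
  shows "subst_word f m (word_power m n) = f (replicate n 1)"
proof -
  have "k = n" if "word_power m k = word_power m n" for k
    using arg_cong[OF that, of length] assms by simp
  moreover have "n \<le> n * length m"
    using assms by (cases m) auto
  ultimately have "{k \<in> {1..length (word_power m n)}. word_power m k = word_power m n} = {n}"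
    using assms by auto
  then show ?thesis
    by (simp add: subst_word_def)
qed

lemma subst_word_eq_0:
  assumes "\<nexists>n. n \<ge> 1 \<and> w = word_power m n"
  shows "subst_word f m w = 0"
proof -
  have "{n \<in> {1..length w}. word_power m n = w} = {}"
    using assms by auto
  then show ?thesis
    unfolding subst_word_def by (simp only: sum.empty)
qed

lemma R_diagonal_imp_B_cumulant_eq_0:
  assumes R: "R_diagonal scale B \<phi> x y" and b: "range b \<subseteq> B"
    and w: "w \<noteq> []" "set w \<subseteq> {1, 2}"
    and not_power: "\<nexists>n. n \<ge> 1 \<and> (w = word_power [1, 2] n \<or> w = word_power [2, 1] n)"
  shows "B_cumulant scale \<phi> [x, y] w b = 0"
proof -
  \<comment> \<open>R-diagonality speaks of a family of coefficients indexed by words; the constant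
    family tests the given \<open>b\<close> on \<open>w\<close>.\<close>
  obtain f g where fg: "\<And>w. R_transform scale \<phi> [x, y] (\<lambda>_. b) w =
      subst_word f [1, 2] w + subst_word g [2, 1] w"
    using R b unfolding R_diagonal_def by (metis (no_types, lifting))
  have "subst_word f [1, 2] w = 0" "subst_word g [2, 1] w = 0"
    using not_power by (blast intro: subst_word_eq_0)+
  moreover have "{1..length [x, y]} = {1, 2}"
    by auto
  ultimately show ?thesis
    using fg[of w] w by (simp only: R_transform_def if_True simp_thms add_0_left)
qed

lemma (in ncps) R_diagonalI:
  assumes vanishing: "\<And>w. \<lbrakk>w \<noteq> []; set w \<subseteq> {1, 2};
      \<nexists>n. n \<ge> 1 \<and> (w = word_power [1, 2] n \<or> w = word_power [2, 1] n)\<rbrakk>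
      \<Longrightarrow> vanishing_B_cumulant scale B \<phi> [x, y] w"
  shows "R_diagonal scale B \<phi> x y"
  unfolding R_diagonal_def
proof (intro allI impI)
  fix b :: "nat list \<Rightarrow> nat \<Rightarrow> 'a"
  assume b: "\<forall>w. range (b w) \<subseteq> B"
  \<comment> \<open>\<open>h m\<close> has as its n-th coefficient the cumulant of the n-th power of
    \<open>m\<close>, taken with the coefficients that \<open>b\<close> assigns to that power. The
    witnesses are f = \<open>h [1, 2]\<close> and g = \<open>h [2, 1]\<close>; the value 0 off the
    words in the letter 1 is what \<open>Theta\<close> demands.\<close>
  define h where "h m v = (if v \<noteq> [] \<and> set v \<subseteq> {1::nat}
      then B_cumulant scale \<phi> [x, y] (word_power m (length v)) (b (word_power m (length v)))
      else 0)" for m and v :: "nat list"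
  have h_Theta: "h m \<in> Theta B 1" for m
    by (simp add: h_def Theta_def B_cumulant_in_B)
  have h_power: "subst_word (h m) m w = B_cumulant scale \<phi> [x, y] w (b w)"
    if "m \<noteq> []" "n \<ge> 1" "w = word_power m n" for m w n
    using that by (simp add: subst_word_word_power h_def)
  have "R_transform scale \<phi> [x, y] b w = subst_word (h [1, 2]) [1, 2] w + subst_word (h [2, 1]) [2, 1] w"
    for w
  proof -
    have letters: "{1..length [x, y]} = {1, 2}"
      by auto
    consider (xy) n where "n \<ge> 1" "w = word_power [1, 2] n"
      | (yx) n where "n \<ge> 1" "w = word_power [2, 1] n"
      | (other) "\<nexists>n. n \<ge> 1 \<and> (w = word_power [1, 2] n \<or> w = word_power [2, 1] n)"
      by blast
    then show ?thesis
    proof cases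
      case xy
      then have R: "R_transform scale \<phi> [x, y] b w = B_cumulant scale \<phi> [x, y] w (b w)"
        unfolding R_transform_def letters by (auto simp: set_word_power word_power_def)
      \<comment> \<open>The first letter separates powers of 12 from powers of 21, so only one of
        the two substituted series contributes at \<open>w\<close>.\<close>
      have "hd w = 1"
        using xy by (simp add: hd_word_power)
      then have "subst_word (h [2, 1]) [2, 1] w = 0"
        by (intro subst_word_eq_0) (auto simp: hd_word_power)
      then show ?thesis
        using R h_power[of "[1, 2]" n w] xy by simp
    next
      case yx
      then have R: "R_transform scale \<phi> [x, y] b w = B_cumulant scale \<phi> [x, y] w (b w)"
        unfolding R_transform_def letters by (auto simp: set_word_power word_power_def)
      have "hd w = 2"
        using yx by (simp add: hd_word_power)
      then have "subst_word (h [1, 2]) [1, 2] w = 0"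
        by (intro subst_word_eq_0) (auto simp: hd_word_power)
      then show ?thesis
        using R h_power[of "[2, 1]" n w] yx by simp
    next
      case other
      then have "subst_word (h [1, 2]) [1, 2] w = 0" "subst_word (h [2, 1]) [2, 1] w = 0"
        by (blast intro: subst_word_eq_0)+
      moreover have "R_transform scale \<phi> [x, y] b w = 0"
        using vanishing[of w] other b
        unfolding R_transform_def letters vanishing_B_cumulant_def by simp
      ultimately show ?thesis
        by simp
    qed
  qed
  then show "\<exists>f\<in>Theta B 1. \<exists>g\<in>Theta B 1. \<forall>w. R_transform scale \<phi> [x, y] b w =
      subst_word f [1, 2] w + subst_word g [2, 1] w"
    using h_Theta by blast
qed

text \<open>Every positive power of 12 or 21 contains both letters. Hence the exceptional words are
  all mixed, and the pure cumulants of an R-diagonal pair must vanish without exception.\<close>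

lemma not_pure_word_power:
  assumes "pure_word w" "n \<ge> 1"
  shows "w \<noteq> word_power [1, 2] n" "w \<noteq> word_power [2, 1] n"
proof -
  have "set w \<noteq> {1, 2}" "set w \<noteq> {2, 1}"
    using assms(1) unfolding pure_word_def by fastforce+
  moreover have "set (word_power [1, 2] n) = {1, 2}" "set (word_power [2, 1] n) = {2, 1}"
    using assms(2) by (simp_all add: set_word_power)
  ultimately show "w \<noteq> word_power [1, 2] n" "w \<noteq> word_power [2, 1] n"
    by metis+
qed

text \<open>This matches the mixed/pure split of the theorem with the words on which the R-transform
  of two variables is given by cumulants.\<close>

lemma mixed_or_pure_word_iff: "mixed_word w \<or> pure_word w \<longleftrightarrow> w \<noteq> [] \<and> set w \<subseteq> {1, 2}"
proof -
  have "S \<subseteq> {1, 2} \<longleftrightarrow> S = {} \<or> S = {1} \<or> S = {2} \<or> S = {1, 2}" for S :: "nat set"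
    by blast
  from this[of "set w"] show ?thesis
    unfolding mixed_word_def pure_word_def by (metis insert_not_empty set_empty)
qed

theorem theorem2p5:
  fixes scale :: "complex \<Rightarrow> 'a::{ring, monoid_mult} \<Rightarrow> 'a"
    and B :: "'a set" and \<phi> :: "'a \<Rightarrow> 'a" and x y :: 'a
  assumes "ncps scale B \<phi>"
    and "B_trace \<phi>"
  shows "R_diagonal scale B \<phi> x y \<longleftrightarrow>
    (\<forall>w. mixed_word w \<and> \<not> vanishing_B_cumulant scale B \<phi> [x, y] w \<longrightarrow>
       (\<exists>n\<ge>1. w = word_power [1, 2] n \<or> w = word_power [2, 1] n)) \<and>
    (\<forall>w. pure_word w \<longrightarrow> vanishing_B_cumulant scale B \<phi> [x, y] w)"
    (is "?R \<longleftrightarrow> ?mixed \<and> ?pure")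
proof
  assume R: ?R
  have vanishing: "vanishing_B_cumulant scale B \<phi> [x, y] w"
    if "mixed_word w \<or> pure_word w"
      "\<nexists>n. n \<ge> 1 \<and> (w = word_power [1, 2] n \<or> w = word_power [2, 1] n)" for w
    using that R_diagonal_imp_B_cumulant_eq_0[OF R]
    unfolding vanishing_B_cumulant_def mixed_or_pure_word_iff by blast
  then show "?mixed \<and> ?pure"
    using not_pure_word_power by blast
next
  assume "?mixed \<and> ?pure"
  then show ?R
    by (intro ncps.R_diagonalI[OF assms(1)]) (use mixed_or_pure_word_iff in meson)
qed

end
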